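(* Let $[a,b]\subset\mathbb R$, $a<b$. (i) Let $\nu$ be an absolutely continuous increasing function on $[a,b]$ with $\nu(a)=0$, $\nu(b)=1$ (the distribution function of a probability measure). If its density $\nu'$ belongs to the class $\mathcal L^-[a,b]$, then $\nu\in\mathcal A[a,b]$. (ii) Consequently, let $M\in\mathcal L^{++}[a,b]$ and let $\nu$ be the absolutely continuous probability measure on $[a,b]$ whose density is $\nu'(t)=\kappa\min\{1,1/\log^+M(t)\}$ (with $1/0=+\infty$), where $\kappa>0$ is the normalizing constant. Then $\nu\in\mathcal A[a,b]$, and there is a constant $C$ depending only on $M$ and $[a,b]$ such that, whenever $f$ is a holomorphic function in an open set $D\subset\mathbb C$ and $\gamma:[a,b]\to D$ is a continuous map with $|f(\gamma(t))|\le M(t)$ for all $t\in[a,b]$, one has $$\int_a^b\log^+|f(\gamma(t))|\,d\nu(t)\le C.$$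
   Context: For a real-valued function $h$, $h^+=\max\{h,0\}$ and $h^-=h^+-h=\max\{-h,0\}$. $\mathcal L^{++}[a,b]$ is the class of nonnegative measurable functions $M$ on $[a,b]$ with $\int_a^b\log^+\log^+M(t)\,dt<\infty$. $\mathcal L^-[a,b]$ is the class of all nonnegative integrable functions $g$ on $[a,b]$ such that $\int_a^b\log^-g(s)\,ds<\infty$ (with $\log^-0=+\infty$). The class $\mathcal A[a,b]$: let $\nu$ be a probability measure on a segment $[a,b]\subset\mathbb R$, identified with its distribution function $\nu(t)=\nu([a,t])$. Suppose $\nu(t)$ is strictly increasing and continuous on $[a,b]$, and let $\mu$ be its inverse function (defined on $[0,1]$), extended to the whole real axis by $\mu(t)=a$ for $t<0$ and $\mu(t)=b$ for $t>1$. Then $\nu\in\mathcal A[a,b]$ means that $$\lim_{\delta\to0}\ \sup_{x\in\mathbb R}\int_0^\delta\frac{\mu(x+t)-\mu(x-t)}{t}\,dt=0.$$ *)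

theory Defs
  imports "HOL-Probability.Probability"
begin

text \<open>Since \<^term>\<open>ln (0::real) = 0\<close>, this gives \<open>log\<^sup>+ 0 = 0\<close>, as required.\<close>

definition log_plus :: "real \<Rightarrow> real" where
  "log_plus x = max (ln x) 0"

text \<open>Only meant for nonnegative arguments; it takes values in \<^typ>\<open>ennreal\<close> because of
  the convention \<open>log\<^sup>- 0 = \<infinity>\<close>.\<close>

definition log_minus :: "real \<Rightarrow> ennreal" where
  "log_minus x = (if x = 0 then \<infinity> else ennreal (max (- ln x) 0))"

definition class_Lpp :: "real \<Rightarrow> real \<Rightarrow> (real \<Rightarrow> real) set" where
  "class_Lpp a b = {M. M \<in> borel_measurable (lebesgue_on {a..b}) \<and> (\<forall>t\<in>{a..b}. 0 \<le> M t) \<and>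
     (\<integral>\<^sup>+t. ennreal (log_plus (log_plus (M t))) \<partial>lebesgue_on {a..b}) < \<infinity>}"

definition class_Lminus :: "real \<Rightarrow> real \<Rightarrow> (real \<Rightarrow> real) set" where
  "class_Lminus a b = {g. integrable (lebesgue_on {a..b}) g \<and> (\<forall>s\<in>{a..b}. 0 \<le> g s) \<and>
     (\<integral>\<^sup>+s. log_minus (g s) \<partial>lebesgue_on {a..b}) < \<infinity>}"

definition ext_inverse :: "real \<Rightarrow> real \<Rightarrow> (real \<Rightarrow> real) \<Rightarrow> real \<Rightarrow> real" where
  "ext_inverse a b \<nu> t =
     (if t < 0 then a else if t > 1 then b else the_inv_into {a..b} \<nu> t)"

text \<open>Probability measures on \<open>[a,b]\<close> are represented by their distribution functions, of which
  only the values on \<open>[a,b]\<close> matter. The conditions \<open>\<nu> a = 0\<close> and \<open>\<nu> b = 1\<close> say that \<open>\<nu>\<close> is the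
  distribution function of a probability measure on \<open>[a,b]\<close> (a continuous one has no atom at
  \<open>a\<close>). The integrand is nonnegative because \<open>ext_inverse a b \<nu>\<close> is increasing, so nothing is
  lost by integrating in \<^typ>\<open>ennreal\<close>, where the integral and the supremum may be \<open>\<infinity>\<close>.\<close>

definition class_A :: "real \<Rightarrow> real \<Rightarrow> (real \<Rightarrow> real) set" where
  "class_A a b = {\<nu>. \<nu> a = 0 \<and> \<nu> b = 1 \<and> strict_mono_on {a..b} \<nu> \<and> continuous_on {a..b} \<nu> \<and>
     ((\<lambda>\<delta>. SUP x. \<integral>\<^sup>+t\<in>{0<..<\<delta>}.
         ennreal ((ext_inverse a b \<nu> (x + t) - ext_inverse a b \<nu> (x - t)) / t) \<partial>lborel)
       \<longlongrightarrow> 0) (at_right 0)}"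

definition abs_continuous_on :: "real \<Rightarrow> real \<Rightarrow> (real \<Rightarrow> real) \<Rightarrow> bool" where
  "abs_continuous_on a b F \<longleftrightarrow> (\<forall>\<epsilon>>0. \<exists>\<delta>>0. \<forall>(n::nat) s t.
     (\<forall>i<n. a \<le> s i \<and> s i \<le> t i \<and> t i \<le> b) \<and>
     disjoint_family_on (\<lambda>i. {s i<..<t i}) {..<n} \<and>
     (\<Sum>i<n. t i - s i) < \<delta> \<longrightarrow> (\<Sum>i<n. \<bar>F (t i) - F (s i)\<bar>) < \<epsilon>)"

text \<open>\<open>g\<close> is a representative of \<open>F'\<close>, which for an absolutely continuous function is only
  determined almost everywhere.\<close>

definition ae_derivative_on :: "real \<Rightarrow> real \<Rightarrow> (real \<Rightarrow> real) \<Rightarrow> (real \<Rightarrow> real) \<Rightarrow> bool" where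
  "ae_derivative_on a b F g \<longleftrightarrow>
     (AE t in lebesgue_on {a..b}. (F has_real_derivative g t) (at t within {a..b}))"

text \<open>The quotient is taken in \<^typ>\<open>ennreal\<close>, where \<open>1 / 0 = \<infinity>\<close>.\<close>

definition loglog_measure :: "real \<Rightarrow> real \<Rightarrow> (real \<Rightarrow> real) \<Rightarrow> real \<Rightarrow> real measure" where
  "loglog_measure a b M \<kappa> = density (lebesgue_on {a..b})
     (\<lambda>t. ennreal \<kappa> * min 1 (1 / ennreal (log_plus (M t))))"

definition distribution_function :: "real \<Rightarrow> real measure \<Rightarrow> real \<Rightarrow> real" where
  "distribution_function a N t = measure N {a..t}"

end

theory Submission
  imports Defs
begin

text \<open>Write \<open>m(t)\<close> for the Lebesgue measure of the set where the density \<open>g\<close> is less than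
  \<open>\<surd>t\<close>. The increment \<open>\<mu>(x+t) - \<mu>(x-t)\<close> of the inverse function is the length of an interval \<open>I\<close>
  whose \<open>\<nu>\<close>-measure is at most \<open>2t\<close>. On the part of \<open>I\<close> where \<open>g \<ge> \<surd>t\<close> Chebyshev's inequality
  applies, so that this part has length at most \<open>2t / \<surd>t = 2\<surd>t\<close>, whence
  \<open>\<bar>I\<bar> \<le> m(t) + 2\<surd>t\<close>. This bound does not depend on \<open>x\<close>; it therefore suffices that
  \<open>m(t)/t + 2/\<surd>t\<close> is integrable on \<open>(0,1)\<close>, because its integral over \<open>(0,\<delta>)\<close> then tends to \<open>0\<close>.
  The second term is harmless, and Tonelli's theorem turns the integral of the first into
  \<open>\<integral> 2 log\<^sup>- g(s) ds\<close>, since \<open>\<integral> dt/t\<close> over \<open>g(s)\<^sup>2 < t < 1\<close> equals \<open>2 log\<^sup>- g(s)\<close>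
  (lemma \<open>class_A_if_density_le_increment\<close>).

  The link between \<open>g\<close> and \<open>\<nu>\<close> is that \<open>\<integral> g\<close> over an interval is at most the increment of \<open>\<nu>\<close>. For the
  almost everywhere derivative of a monotone function this follows from Fatou's lemma applied to
  difference quotients (lemma \<open>nn_integral_derivative_le_increment\<close>). For the second part the
  inequality is an equality by construction, and the density \<open>\<kappa> / max {1, log\<^sup>+ M}\<close> satisfies
  \<open>log\<^sup>- \<le> \<bar>log \<kappa>\<bar> + log\<^sup>+ log\<^sup>+ M\<close>. Its product with \<open>log\<^sup>+ \<bar>f(\<gamma>(t))\<bar> \<le> log\<^sup>+ M\<close> is at
  most \<open>\<kappa>\<close>, so \<open>C = \<kappa> (b - a)\<close> is a possible constant.\<close>

section \<open>Integrals over small intervals and sublevel sets\<close>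

lemma set_nn_integral_near_zero_tendsto_zero:
  fixes \<Phi> :: "real \<Rightarrow> ennreal"
  assumes [measurable]: "\<Phi> \<in> borel_measurable borel"
    and fin: "(\<integral>\<^sup>+t\<in>{0<..<1}. \<Phi> t \<partial>lborel) < \<infinity>"
  shows "((\<lambda>\<delta>. \<integral>\<^sup>+t\<in>{0<..<\<delta>}. \<Phi> t \<partial>lborel) \<longlongrightarrow> 0) (at_right 0)"
proof -
  define f where "f n t = \<Phi> t * indicator {0<..<1 / real (Suc n)} t" for n t
  have "decseq f"
  proof (intro decseq_SucI le_funI)
    fix n :: nat and x :: real
    have "1 / real (Suc (Suc n)) \<le> 1 / real (Suc n)" by (simp add: frac_le)
    then show "f (Suc n) x \<le> f n x"
      unfolding f_def by (intro mult_left_mono) (auto split: split_indicator)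
  qed
  then have "(\<integral>\<^sup>+ x. (INF i. f i x) \<partial>lborel) = (INF i. integral\<^sup>N lborel (f i))"
    using fin by (intro nn_integral_monotone_convergence_INF_decseq[where i=0]) (simp_all add: f_def[abs_def])
  moreover have "(INF i. f i x) = 0" for x
  proof -
    have "\<exists>n. f n x = 0"
    proof (cases "x > 0")
      case True
      then obtain n where "1 / real (Suc n) < x" using nat_approx_posE by blast
      then show ?thesis by (auto simp: f_def split: split_indicator intro!: exI[of _ n])
    qed (auto simp: f_def)
    then obtain n where "f n x = 0" by blast
    then have "(INF i. f i x) \<le> 0" by (metis INF_lower UNIV_I)
    then show ?thesis by simp
  qed
  ultimately have INF0: "(INF i. integral\<^sup>N lborel (f i)) = 0" by simp
  show ?thesis
  proof (rule order_tendstoI)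
    fix e :: ennreal assume "0 < e"
    then obtain n where n: "integral\<^sup>N lborel (f n) < e"
      using INF0 by (metis INF_less_iff)
    have "eventually (\<lambda>\<delta>. \<delta> < 1 / real (Suc n)) (at_right (0::real))"
      by (rule eventually_at_rightI[of 0 "1 / real (Suc n)"]) auto
    then show "eventually (\<lambda>\<delta>. (\<integral>\<^sup>+t\<in>{0<..<\<delta>}. \<Phi> t \<partial>lborel) < e) (at_right 0)"
    proof eventually_elim
      case (elim \<delta>)
      have "(\<integral>\<^sup>+t\<in>{0<..<\<delta>}. \<Phi> t \<partial>lborel) \<le> integral\<^sup>N lborel (f n)"
        unfolding f_def using elim by (intro nn_integral_mono mult_left_mono) (auto split: split_indicator)
      with n show ?case by simp
    qed
  qed simp
qed

text \<open>For \<open>0 < y < 1\<close> the domain of integration is \<open>y\<^sup>2 < t < 1\<close> and the integral is \<open>-ln (y\<^sup>2)\<close>.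
  The right-hand side is \<open>\<infinity>\<close> when \<open>y = 0\<close>, so zeros of a density need no separate treatment below.\<close>

lemma nn_integral_inverse_above_square:
  fixes y :: real
  assumes "0 \<le> y"
  shows "(\<integral>\<^sup>+t\<in>{0<..<1}. (if y < sqrt t then ennreal (1 / t) else 0) \<partial>lborel) \<le> 2 * log_minus y"
proof -
  consider "y = 0" | "y \<ge> 1" | "0 < y" "y < 1" using assms by linarith
  then show ?thesis
  proof cases
    case 1
    then show ?thesis by (simp add: log_minus_def ennreal_mult_top)
  next
    case 2
    have "\<not> y < sqrt t" if "t < 1" for t
    proof -
      have "sqrt t < 1" using that by simp
      with 2 show ?thesis by linarith
    qed
    then have "(if y < sqrt t then ennreal (1 / t) else 0) * indicator {0<..<1} t = 0" for t
      by (auto split: split_indicator)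
    then show ?thesis by (simp only: nn_integral_const mult_zero_left zero_le)
  next
    case 3
    have y2: "y\<^sup>2 \<le> 1" "0 < y\<^sup>2" using 3 by (auto simp: power_le_one)
    have "(\<integral>\<^sup>+t\<in>{0<..<1}. (if y < sqrt t then ennreal (1 / t) else 0) \<partial>lborel)
        \<le> (\<integral>\<^sup>+t. ennreal (1 / t) * indicator {y\<^sup>2..1} t \<partial>lborel)"
    proof (rule nn_integral_mono)
      fix t :: real
      have "y\<^sup>2 \<le> t" if "y < sqrt t" "0 < t"
        using that 3 by (metis less_eq_real_def real_less_rsqrt not_less real_sqrt_abs abs_of_pos real_sqrt_less_iff)
      then show "(if y < sqrt t then ennreal (1 / t) else 0) * indicator {0<..<1} t
          \<le> ennreal (1 / t) * indicator {y\<^sup>2..1} t"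
        by (auto split: split_indicator)
    qed
    also have "\<dots> = ennreal (ln 1 - ln (y\<^sup>2))"
    proof (rule nn_integral_FTC_Icc)
      fix t assume "t \<in> {y\<^sup>2..1}"
      then have "y\<^sup>2 \<le> t" by simp
      with y2 have "0 < t" by linarith
      then show "(ln has_real_derivative 1 / t) (at t)" "0 \<le> 1 / t"
        by (auto intro!: derivative_eq_intros)
    qed (use y2 in auto)
    also have "\<dots> = 2 * log_minus y"
      using 3 ennreal_mult'[of 2 "- ln y"]
      by (simp add: log_minus_def ln_realpow max_def ln_less_zero)
    finally show ?thesis .
  qed
qed

text \<open>Tonelli's theorem reduces the second claim to the preceding lemma with \<open>y = g(s)\<close>.\<close>

lemma nn_integral_sublevel_le_log_minus:
  fixes g :: "real \<Rightarrow> real"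
  assumes [measurable]: "g \<in> borel_measurable (lebesgue_on {a..b})"
    and nonneg: "\<And>s. s \<in> {a..b} \<Longrightarrow> 0 \<le> g s"
  shows "(\<lambda>t. emeasure (lebesgue_on {a..b}) {s \<in> {a..b}. g s < sqrt t}) \<in> borel_measurable borel"
    and "(\<integral>\<^sup>+t\<in>{0<..<1}. emeasure (lebesgue_on {a..b}) {s \<in> {a..b}. g s < sqrt t} * ennreal (1 / t) \<partial>lborel)
      \<le> 2 * (\<integral>\<^sup>+s. log_minus (g s) \<partial>lebesgue_on {a..b})"
proof -
  define L where "L = lebesgue_on {a..b}"
  have L[simp]: "space L = {a..b}" by (simp add: L_def)
  note [measurable] = assms(1)[folded L_def]
  interpret L: finite_measure L
    unfolding L_def by (metis cbox_interval finite_measure_lebesgue_on lmeasurable_cbox)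
  interpret P: pair_sigma_finite lborel L ..
  have "(\<lambda>t. emeasure L {s \<in> space L. g s < sqrt t}) \<in> borel_measurable lborel"
    by measurable
  then show M[measurable]: "(\<lambda>t. emeasure L {s \<in> {a..b}. g s < sqrt t}) \<in> borel_measurable borel"
    by simp
  have "(\<integral>\<^sup>+t\<in>{0<..<1}. emeasure L {s \<in> {a..b}. g s < sqrt t} * ennreal (1 / t) \<partial>lborel)
      = (\<integral>\<^sup>+t. (\<integral>\<^sup>+s. (if g s < sqrt t then ennreal (1 / t) else 0) * indicator {0<..<1} t \<partial>L) \<partial>lborel)"
  proof (rule nn_integral_cong)
    fix t :: real
    have "(\<integral>\<^sup>+s. (if g s < sqrt t then ennreal (1 / t) else 0) * indicator {0<..<1} t \<partial>L)
      = (\<integral>\<^sup>+s. (ennreal (1 / t) * indicator {0<..<1} t) * indicator {s \<in> space L. g s < sqrt t} s \<partial>L)"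
      by (intro nn_integral_cong) (auto split: split_indicator)
    also have "\<dots> = (ennreal (1 / t) * indicator {0<..<1} t) * emeasure L {s \<in> space L. g s < sqrt t}"
      by (rule nn_integral_cmult_indicator) measurable
    finally show "emeasure L {s \<in> {a..b}. g s < sqrt t} * ennreal (1 / t) * indicator {0<..<1} t =
       (\<integral>\<^sup>+s. (if g s < sqrt t then ennreal (1 / t) else 0) * indicator {0<..<1} t \<partial>L)"
      by (simp add: mult_ac)
  qed
  also have "\<dots> = (\<integral>\<^sup>+s. (\<integral>\<^sup>+t. (if g s < sqrt t then ennreal (1 / t) else 0) * indicator {0<..<1} t \<partial>lborel) \<partial>L)"
    by (rule P.Fubini'[symmetric]) measurable
  also have "\<dots> \<le> (\<integral>\<^sup>+s. 2 * log_minus (g s) \<partial>L)"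
    using nonneg by (intro nn_integral_mono nn_integral_inverse_above_square) simp
  also have "\<dots> = 2 * (\<integral>\<^sup>+s. log_minus (g s) \<partial>L)"
    unfolding log_minus_def by (intro nn_integral_cmult) measurable
  finally show "(\<integral>\<^sup>+t\<in>{0<..<1}. emeasure L {s \<in> {a..b}. g s < sqrt t} * ennreal (1 / t) \<partial>lborel)
      \<le> 2 * (\<integral>\<^sup>+s. log_minus (g s) \<partial>L)" .
qed

text \<open>The part of \<open>[p,q]\<close> where \<open>g \<ge> c\<close> is controlled by Chebyshev's inequality, and the rest lies in the
  sublevel set, whose measure does not depend on the interval.\<close>

lemma length_le_sublevel_plus_integral:
  fixes g :: "real \<Rightarrow> real"
  assumes [measurable]: "g \<in> borel_measurable (lebesgue_on {a..b})"
    and "a \<le> p" "p \<le> q" "q \<le> b" "0 < c"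
    and I: "(\<integral>\<^sup>+s\<in>{p..q}. ennreal (g s) \<partial>lebesgue_on {a..b}) \<le> ennreal I" "0 \<le> I"
  shows "ennreal (q - p) \<le> emeasure (lebesgue_on {a..b}) {s \<in> {a..b}. g s < c} + ennreal (I / c)"
proof -
  define L where "L = lebesgue_on {a..b}"
  have L[simp]: "space L = {a..b}" by (simp add: L_def)
  note [measurable] = assms(1)[folded L_def]
  have pq[measurable]: "{p..q} \<in> sets L"
    using assms by (auto simp: L_def sets_restrict_space_iff)
  define B where "B = {s \<in> space L. g s < c}"
  define G where "G = {s \<in> space L. c \<le> g s} \<inter> {p..q}"
  have [measurable]: "B \<in> sets L" "G \<in> sets L" unfolding B_def G_def by measurable
  have "ennreal c * emeasure L G = (\<integral>\<^sup>+s. ennreal c * indicator G s \<partial>L)"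
    by (rule nn_integral_cmult_indicator[symmetric]) measurable
  also have "\<dots> \<le> (\<integral>\<^sup>+s\<in>{p..q}. ennreal (g s) \<partial>L)"
    by (intro nn_integral_mono) (auto simp: G_def split: split_indicator intro: ennreal_leI)
  also have "\<dots> \<le> ennreal I" using I by (simp add: L_def)
  also have "\<dots> = ennreal c * ennreal (I / c)"
    using \<open>0 < c\<close> \<open>0 \<le> I\<close> by (simp flip: ennreal_mult')
  finally have G: "emeasure L G \<le> ennreal (I / c)"
    using \<open>0 < c\<close> by (subst (asm) ennreal_mult_le_mult_iff) auto
  have "ennreal (q - p) = emeasure L {p..q}"
    using assms by (simp add: L_def emeasure_restrict_space)
  also have "\<dots> \<le> emeasure L (B \<union> G)"
    using assms by (intro emeasure_mono sets.Un \<open>B \<in> sets L\<close> \<open>G \<in> sets L\<close>) (auto simp: B_def G_def)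
  also have "\<dots> \<le> emeasure L B + emeasure L G"
    by (intro emeasure_subadditive) measurable
  also have "\<dots> \<le> emeasure L B + ennreal (I / c)"
    using G by (rule add_left_mono)
  finally show ?thesis by (simp add: L_def B_def)
qed

lemma nn_integral_two_div_sqrt: "(\<integral>\<^sup>+t\<in>{0<..<1}. ennreal (2 / sqrt t) \<partial>lborel) < \<infinity>"
proof -
  have "((\<lambda>t::real. t powr (-1/2)) has_integral (1 powr (-1/2 + 1) / (-1/2 + 1))) {0..1}"
    by (rule has_integral_powr_from_0) auto
  then have "((\<lambda>t::real. 2 * t powr (-1/2)) has_integral 4) {0..1}"
    by (auto dest: has_integral_mult_right[where c=2])
  then have "(\<integral>\<^sup>+t. ennreal (indicator {0..1} t * (2 * t powr (-1/2))) \<partial>lborel) = ennreal 4"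
    by (intro nn_integral_has_integral_lebesgue) auto
  moreover have "(\<integral>\<^sup>+t\<in>{0<..<1}. ennreal (2 / sqrt t) \<partial>lborel)
     \<le> (\<integral>\<^sup>+t. ennreal (indicator {0..1} t * (2 * t powr (-1/2))) \<partial>lborel)"
    by (intro nn_integral_mono)
       (auto split: split_indicator simp: powr_minus powr_half_sqrt divide_simps)
  ultimately show ?thesis by (simp add: order_le_less_trans)
qed

section \<open>A criterion for membership in the class A\<close>

text \<open>The analytic core of both parts. Strict monotonicity of \<open>\<nu>\<close> comes for free, since
  \<open>\<integral> log\<^sup>- g < \<infinity>\<close> forces \<open>g > 0\<close> almost everywhere.\<close>

lemma class_A_if_density_le_increment:
  fixes a b :: real and \<nu> g :: "real \<Rightarrow> real"
  assumes ab: "a < b" and cont: "continuous_on {a..b} \<nu>" and mono: "mono_on {a..b} \<nu>"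
    and ends: "\<nu> a = 0" "\<nu> b = 1" and g: "g \<in> class_Lminus a b"
    and increment: "\<And>s t. a \<le> s \<Longrightarrow> s \<le> t \<Longrightarrow> t \<le> b \<Longrightarrow>
      (\<integral>\<^sup>+x\<in>{s..t}. ennreal (g x) \<partial>lebesgue_on {a..b}) \<le> ennreal (\<nu> t - \<nu> s)"
  shows "\<nu> \<in> class_A a b"
proof -
  define L where "L = lebesgue_on {a..b}"
  have L[simp]: "space L = {a..b}" by (simp add: L_def)
  have gm: "g \<in> borel_measurable (lebesgue_on {a..b})"
    using g by (auto simp: class_Lminus_def)
  note [measurable] = gm[folded L_def]
  have g0: "0 \<le> g s" if "s \<in> {a..b}" for s using g that by (auto simp: class_Lminus_def)
  have gfin: "(\<integral>\<^sup>+s. log_minus (g s) \<partial>L) < \<infinity>" using g by (auto simp: class_Lminus_def L_def)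
  have "(\<lambda>s. log_minus (g s)) \<in> borel_measurable L" unfolding log_minus_def by measurable
  then have "AE s in L. log_minus (g s) \<noteq> \<infinity>"
    using gfin by (intro nn_integral_PInf_AE) auto
  then have gpos: "AE s in L. g s \<noteq> 0" by eventually_elim (auto simp: log_minus_def)
  have strict: "strict_mono_on {a..b} \<nu>"
  proof (rule strict_mono_onI)
    fix s t assume st: "s \<in> {a..b}" "t \<in> {a..b}" "s < t"
    have [measurable]: "{s..t} \<in> sets L" using st by (auto simp: L_def sets_restrict_space_iff)
    have "\<nu> s \<noteq> \<nu> t"
    proof
      assume "\<nu> s = \<nu> t"
      then have "(\<integral>\<^sup>+x\<in>{s..t}. ennreal (g x) \<partial>L) = 0"
        using increment[of s t] st by (simp add: L_def)
      then have "AE x in L. ennreal (g x) * indicator {s..t} x = 0"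
        by (subst (asm) nn_integral_0_iff_AE) measurable
      with gpos have "AE x in L. x \<notin> {s..t}"
        using AE_space
      proof eventually_elim
        case (elim x)
        then have "0 < g x" using g0[of x] by auto
        with elim show ?case by (auto split: split_indicator_asm)
      qed
      then have "emeasure L {s..t} = 0"
        using st by (subst (asm) AE_iff_measurable[where N="{s..t}"]) auto
      then show False using st by (simp add: L_def emeasure_restrict_space)
    qed
    moreover have "\<nu> s \<le> \<nu> t" using mono st by (auto simp: mono_on_def)
    ultimately show "\<nu> s < \<nu> t" by simp
  qed
  then have inj: "inj_on \<nu> {a..b}" by (rule strict_mono_on_imp_inj_on)
  define \<mu> where "\<mu> = ext_inverse a b \<nu>"
  \<comment> \<open>The extension of the inverse by constants amounts to clamping its argument to \<open>[0,1]\<close>. As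
    clamping is a contraction, increments of \<open>\<nu> \<circ> \<mu>\<close> are bounded by those of the argument.\<close>
  have \<mu>: "\<mu> z \<in> {a..b} \<and> \<nu> (\<mu> z) = max 0 (min 1 z)" for z
  proof -
    consider "z < 0" | "z > 1" | "0 \<le> z" "z \<le> 1" by linarith
    then show ?thesis
    proof cases
      case 3
      then obtain y where y: "y \<in> {a..b}" "\<nu> y = z"
        using IVT'[of \<nu> a z b] cont ends ab by auto
      then have "the_inv_into {a..b} \<nu> z = y" using inj the_inv_into_f_f by metis
      with y 3 show ?thesis by (simp add: \<mu>_def ext_inverse_def)
    qed (use ab ends in \<open>auto simp: \<mu>_def ext_inverse_def\<close>)
  qed
  have \<mu>_mono: "\<mu> y \<le> \<mu> z" if "y \<le> z" for y z
  proof (rule ccontr)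
    assume "\<not> \<mu> y \<le> \<mu> z"
    then have "\<nu> (\<mu> z) < \<nu> (\<mu> y)"
      using \<mu>[of y] \<mu>[of z] by (intro strict_mono_onD[OF strict]) auto
    then show False using \<mu>[of y] \<mu>[of z] that by auto
  qed
  define m where "m t = emeasure L {s \<in> {a..b}. g s < sqrt t}" for t
  \<comment> \<open>The majorant of the integrand, uniform in \<open>x\<close>. The threshold \<open>\<surd>t\<close> balances two demands:
    \<open>2t / \<surd>t\<close> must be integrable against \<open>dt/t\<close>, while solving \<open>g < \<surd>t\<close> for \<open>t\<close> must change
    \<open>log g\<close> by no more than a constant factor.\<close>
  define \<Phi> where "\<Phi> t = m t * ennreal (1 / t) + ennreal (2 / sqrt t)" for t
  have [measurable]: "m \<in> borel_measurable borel"
    using nn_integral_sublevel_le_log_minus(1)[OF gm g0] by (simp add: m_def[abs_def] L_def)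
  have [measurable]: "\<Phi> \<in> borel_measurable borel" unfolding \<Phi>_def[abs_def] by measurable
  have bound: "ennreal ((\<mu> (x + t) - \<mu> (x - t)) / t) \<le> \<Phi> t" if "0 < t" for x t
  proof -
    define p q where "p = \<mu> (x - t)" and "q = \<mu> (x + t)"
    have pq: "a \<le> p" "p \<le> q" "q \<le> b"
      using \<mu>[of "x - t"] \<mu>[of "x + t"] \<mu>_mono[of "x - t" "x + t"] \<open>0 < t\<close> by (auto simp: p_def q_def)
    have "\<nu> q - \<nu> p \<le> 2 * t" using \<mu>[of "x - t"] \<mu>[of "x + t"] \<open>0 < t\<close> by (auto simp: p_def q_def)
    then have "(\<integral>\<^sup>+s\<in>{p..q}. ennreal (g s) \<partial>lebesgue_on {a..b}) \<le> ennreal (2 * t)"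
      using increment[OF pq] by (meson ennreal_leI order_trans)
    then have "ennreal (q - p) \<le> m t + ennreal (2 * t / sqrt t)"
      unfolding m_def L_def using pq \<open>0 < t\<close> gm by (intro length_le_sublevel_plus_integral) auto
    then have "ennreal (q - p) * ennreal (1 / t) \<le> (m t + ennreal (2 * t / sqrt t)) * ennreal (1 / t)"
      by (rule mult_right_mono) simp
    also have "\<dots> = \<Phi> t"
      using \<open>0 < t\<close> by (simp add: \<Phi>_def distrib_right flip: ennreal_mult)
    finally show ?thesis
      using pq \<open>0 < t\<close> by (simp add: p_def q_def flip: ennreal_mult)
  qed
  have "(\<integral>\<^sup>+t\<in>{0<..<1}. \<Phi> t \<partial>lborel)
      = (\<integral>\<^sup>+t\<in>{0<..<1}. m t * ennreal (1 / t) \<partial>lborel) + (\<integral>\<^sup>+t\<in>{0<..<1}. ennreal (2 / sqrt t) \<partial>lborel)"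
    unfolding \<Phi>_def distrib_right by (intro nn_integral_add) measurable
  moreover have "(\<integral>\<^sup>+t\<in>{0<..<1}. m t * ennreal (1 / t) \<partial>lborel) < \<infinity>"
  proof (rule order_le_less_trans)
    show "(\<integral>\<^sup>+t\<in>{0<..<1}. m t * ennreal (1 / t) \<partial>lborel) \<le> 2 * (\<integral>\<^sup>+s. log_minus (g s) \<partial>L)"
      using nn_integral_sublevel_le_log_minus(2)[OF gm g0] by (simp add: m_def L_def)
    show "2 * (\<integral>\<^sup>+s. log_minus (g s) \<partial>L) < \<infinity>" using gfin by (simp add: ennreal_mult_less_top)
  qed
  ultimately have "(\<integral>\<^sup>+t\<in>{0<..<1}. \<Phi> t \<partial>lborel) < \<infinity>" using nn_integral_two_div_sqrt by simp
  then have lim: "((\<lambda>\<delta>. \<integral>\<^sup>+t\<in>{0<..<\<delta>}. \<Phi> t \<partial>lborel) \<longlongrightarrow> 0) (at_right 0)"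
    by (intro set_nn_integral_near_zero_tendsto_zero) auto
  have "((\<lambda>\<delta>. SUP x. \<integral>\<^sup>+t\<in>{0<..<\<delta>}. ennreal ((\<mu> (x + t) - \<mu> (x - t)) / t) \<partial>lborel)
      \<longlongrightarrow> 0) (at_right 0)"
  proof (rule tendsto_sandwich[OF _ _ tendsto_const lim])
    have "(SUP x. \<integral>\<^sup>+t\<in>{0<..<\<delta>}. ennreal ((\<mu> (x + t) - \<mu> (x - t)) / t) \<partial>lborel)
        \<le> (\<integral>\<^sup>+t\<in>{0<..<\<delta>}. \<Phi> t \<partial>lborel)" for \<delta>
      using bound by (intro SUP_least nn_integral_mono) (auto split: split_indicator)
    then show "eventually (\<lambda>\<delta>. (SUP x. \<integral>\<^sup>+t\<in>{0<..<\<delta>}. ennreal ((\<mu> (x + t) - \<mu> (x - t)) / t) \<partial>lborel)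
        \<le> (\<integral>\<^sup>+t\<in>{0<..<\<delta>}. \<Phi> t \<partial>lborel)) (at_right 0)" by simp
  qed simp
  then show ?thesis
    using cont strict ends by (simp add: class_A_def \<mu>_def)
qed

section \<open>The increment of a monotone function dominates the integral of its derivative\<close>

text \<open>Half of the fundamental theorem of calculus, valid for every monotone function: the integrals
  of the difference quotients with step \<open>h\<close> telescope to boundary terms over intervals of length
  \<open>h\<close>, and Fatou's lemma passes to the limit.\<close>

lemma nn_integral_derivative_le_increment:
  fixes \<nu> g :: "real \<Rightarrow> real"
  assumes mono: "mono_on {a..b} \<nu>" and der: "ae_derivative_on a b \<nu> g"
    and st: "a \<le> s" "s \<le> t" "t \<le> b"
  shows "(\<integral>\<^sup>+x\<in>{s..t}. ennreal (g x) \<partial>lebesgue_on {a..b}) \<le> ennreal (\<nu> t - \<nu> s)"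
proof -
  define \<Delta> where "\<Delta> = \<nu> t - \<nu> s"
  \<comment> \<open>Freezing \<open>\<nu>\<close> outside \<open>[s,t]\<close> keeps the averages over \<open>[t, t + h]\<close> below \<open>\<nu> t\<close>;
    subtracting \<open>\<nu> s\<close> makes the function nonnegative.\<close>
  define G where "G x = \<nu> (max s (min t x)) - \<nu> s" for x
  have G_mono: "mono G"
  proof (rule monoI)
    fix x y :: real assume "x \<le> y"
    then show "G x \<le> G y"
      unfolding G_def using mono st by (intro diff_right_mono) (auto intro!: mono_onD[OF mono])
  qed
  then have [measurable]: "G \<in> borel_measurable borel" by (rule borel_measurable_mono)
  have G0: "0 \<le> G x" and G1: "G x \<le> \<Delta>" for x
    unfolding G_def \<Delta>_def using mono st by (auto intro!: mono_onD[OF mono])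
  define h where "h n = 1 / real (Suc n)" for n
  have h: "0 < h n" for n by (simp add: h_def)
  define q where "q n x = ennreal ((G (x + h n) - G x) / h n) * indicator {s..t} x" for n x
  have [measurable]: "q n \<in> borel_measurable borel" for n unfolding q_def[abs_def] by measurable
  have q_le: "integral\<^sup>N lborel (q n) \<le> ennreal \<Delta>" for n
  proof -
    let ?A = "\<integral>\<^sup>+x\<in>{s..t}. ennreal (G x) \<partial>lborel"
    let ?D = "\<integral>\<^sup>+x\<in>{s..t}. ennreal (G (x + h n) - G x) \<partial>lborel"
    have "?A \<le> (\<integral>\<^sup>+x. ennreal \<Delta> * indicator {s..t} x \<partial>lborel)"
      using G1 by (intro nn_integral_mono) (auto split: split_indicator intro: ennreal_leI)
    also have "\<dots> = ennreal \<Delta> * ennreal (t - s)"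
      using st by (subst nn_integral_cmult_indicator) auto
    also have "\<dots> < \<top>" by (simp add: ennreal_mult_less_top)
    finally have A: "?A \<noteq> \<top>" by simp
    \<comment> \<open>Both \<open>?A + ?D\<close> and its bound contain the finite integral \<open>?A\<close>, which is cancelled at the end;
      subtraction in \<^typ>\<open>ennreal\<close> is thereby avoided.\<close>
    have "?A + ?D = (\<integral>\<^sup>+x. ennreal (G x) * indicator {s..t} x
        + ennreal (G (x + h n) - G x) * indicator {s..t} x \<partial>lborel)"
      by (intro nn_integral_add[symmetric]) measurable
    also have "\<dots> = (\<integral>\<^sup>+x. ennreal (G (x + h n)) * indicator {s + h n..t + h n} (x + h n) \<partial>lborel)"
    proof (rule nn_integral_cong)
      fix x
      have "ennreal (G x) + ennreal (G (x + h n) - G x) = ennreal (G (x + h n))"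
        using G0[of x] monoD[OF G_mono, of x "x + h n"] h[of n] by (simp flip: ennreal_plus)
      then show "ennreal (G x) * indicator {s..t} x + ennreal (G (x + h n) - G x) * indicator {s..t} x
          = ennreal (G (x + h n)) * indicator {s + h n..t + h n} (x + h n)"
        by (auto split: split_indicator)
    qed
    also have "\<dots> = (\<integral>\<^sup>+x. ennreal (G x) * indicator {s + h n..t + h n} x \<partial>lborel)"
      using nn_integral_real_affine[of "\<lambda>x. ennreal (G x) * indicator {s + h n..t + h n} x" 1 "h n"]
      by (simp add: add.commute)
    also have "\<dots> \<le> (\<integral>\<^sup>+x. ennreal (G x) * indicator {s..t} x
        + ennreal \<Delta> * indicator {t..t + h n} x \<partial>lborel)"
      using G1 h[of n]
      by (intro nn_integral_mono) (auto split: split_indicator intro: ennreal_leI)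
    also have "\<dots> = ?A + (\<integral>\<^sup>+x. ennreal \<Delta> * indicator {t..t + h n} x \<partial>lborel)"
      by (intro nn_integral_add) measurable
    also have "(\<integral>\<^sup>+x. ennreal \<Delta> * indicator {t..t + h n} x \<partial>lborel) = ennreal \<Delta> * ennreal (h n)"
      using h[of n] by (subst nn_integral_cmult_indicator) auto
    finally have D: "?D \<le> ennreal \<Delta> * ennreal (h n)"
      using A by (simp add: ennreal_add_left_cancel_le)
    have "integral\<^sup>N lborel (q n) = (\<integral>\<^sup>+x. ennreal (1 / h n) *
        (ennreal (G (x + h n) - G x) * indicator {s..t} x) \<partial>lborel)"
      unfolding q_def using h[of n] G_mono
      by (intro nn_integral_cong) (auto simp flip: ennreal_mult simp: monoD split: split_indicator)
    also have "\<dots> = ennreal (1 / h n) * ?D" by (intro nn_integral_cmult) measurable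
    also have "\<dots> \<le> ennreal (1 / h n) * (ennreal \<Delta> * ennreal (h n))"
      using D by (intro mult_left_mono) auto
    also have "\<dots> = ennreal \<Delta>"
      using h[of n] G0[of s] G1[of s] by (simp flip: ennreal_mult)
    finally show ?thesis .
  qed
  have lim: "(\<lambda>n. q n x) \<longlonglongrightarrow> ennreal (g x)"
    if d: "(\<nu> has_real_derivative g x) (at x within {a..b})" and x: "s < x" "x < t" for x
  proof -
    have "(\<nu> has_real_derivative g x) (at x)"
      using d x st by (subst (asm) at_within_interior) auto
    moreover have "eventually (\<lambda>y. \<nu> y - \<nu> s = G y) (nhds x)"
    proof (rule eventually_nhds_in_open[of "{s<..<t}" x, THEN eventually_mono])
    qed (use x in \<open>auto simp: G_def max_def min_def\<close>)
    ultimately have "(G has_real_derivative g x) (at x)"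
      by (subst DERIV_cong_ev[OF refl _ refl, symmetric, where f= "\<lambda>y. \<nu> y - \<nu> s"])
         (auto intro!: derivative_eq_intros)
    then have "((\<lambda>k. (G (x + k) - G x) / k) \<longlongrightarrow> g x) (at 0)" by (simp add: DERIV_def)
    moreover have "filterlim h (at 0) sequentially"
    proof -
      have "h \<longlonglongrightarrow> 0" using LIMSEQ_inverse_real_of_nat by (simp add: h_def[abs_def] inverse_eq_divide)
      then show ?thesis using h by (auto simp: filterlim_at less_imp_neq[symmetric])
    qed
    ultimately have "(\<lambda>n. (G (x + h n) - G x) / h n) \<longlonglongrightarrow> g x" by (rule filterlim_compose)
    then show ?thesis using x by (auto simp: q_def intro!: tendsto_ennrealI)
  qed
  have sing: "AE x in lebesgue. x \<noteq> c" for c :: real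
    by (intro AE_completion) (rule AE_lborel_singleton)
  have "AE x in lebesgue. x \<in> {a..b} \<longrightarrow> (\<nu> has_real_derivative g x) (at x within {a..b})"
    using der unfolding ae_derivative_on_def by (subst (asm) AE_restrict_space_iff) auto
  with sing[of s] sing[of t]
  have eq: "AE x in lebesgue. ennreal (g x) * indicator {s..t} x * indicator {a..b} x = liminf (\<lambda>n. q n x)"
  proof eventually_elim
    case (elim x)
    show ?case
    proof (cases "x \<in> {s..t}")
      case True
      then have "(\<lambda>n. q n x) \<longlonglongrightarrow> ennreal (g x)" using elim st by (intro lim) auto
      then show ?thesis using True st by (simp add: lim_imp_Liminf)
    qed (simp add: q_def Liminf_const)
  qed
  have "(\<integral>\<^sup>+x\<in>{s..t}. ennreal (g x) \<partial>lebesgue_on {a..b})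
      = (\<integral>\<^sup>+x. ennreal (g x) * indicator {s..t} x * indicator {a..b} x \<partial>lebesgue)"
    by (rule nn_integral_restrict_space) simp
  also have "\<dots> = (\<integral>\<^sup>+x. liminf (\<lambda>n. q n x) \<partial>lebesgue)"
    using eq by (rule nn_integral_cong_AE)
  also have "\<dots> = (\<integral>\<^sup>+x. liminf (\<lambda>n. q n x) \<partial>lborel)" by (simp add: nn_integral_completion)
  also have "\<dots> \<le> liminf (\<lambda>n. integral\<^sup>N lborel (q n))" by (rule nn_integral_liminf) simp
  also have "\<dots> \<le> ennreal \<Delta>"
    using q_le by (intro Liminf_le) auto
  finally show ?thesis by (simp add: \<Delta>_def)
qed

lemma abs_continuous_on_imp_continuous_on:
  assumes "abs_continuous_on a b F"
  shows "continuous_on {a..b} F"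
  unfolding continuous_on_iff
proof (intro ballI allI impI)
  fix x e :: real assume x: "x \<in> {a..b}" and "0 < e"
  then obtain d where "d > 0" and d: "\<And>(n::nat) s t. (\<forall>i<n. a \<le> s i \<and> s i \<le> t i \<and> t i \<le> b) \<Longrightarrow>
     disjoint_family_on (\<lambda>i. {s i<..<t i}) {..<n} \<Longrightarrow>
     (\<Sum>i<n. t i - s i) < d \<Longrightarrow> (\<Sum>i<n. \<bar>F (t i) - F (s i)\<bar>) < e"
    using assms unfolding abs_continuous_on_def by meson
  have "dist (F y) (F x) < e" if "y \<in> {a..b}" "dist y x < d" for y
  proof -
    have "\<bar>F (max x y) - F (min x y)\<bar> < e"
      using d[of 1 "\<lambda>_. min x y" "\<lambda>_. max x y"] x that
      by (auto simp: dist_real_def disjoint_family_on_def)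
    then show ?thesis by (simp add: dist_real_def min_def max_def abs_minus_commute split: if_splits)
  qed
  then show "\<exists>d>0. \<forall>x'\<in>{a..b}. dist x' x < d \<longrightarrow> dist (F x') (F x) < e"
    using \<open>d > 0\<close> by blast
qed

section \<open>The measure with density reciprocal to the logarithm of the majorant\<close>

text \<open>Passing to a real-valued density removes the convention \<open>1 / 0 = \<infinity>\<close>.\<close>

lemma loglog_measure_eq_density:
  assumes "0 < \<kappa>"
  shows "loglog_measure a b M \<kappa> =
    density (lebesgue_on {a..b}) (\<lambda>t. ennreal (\<kappa> / max 1 (log_plus (M t))))"
proof -
  have "ennreal \<kappa> * min 1 (1 / ennreal (log_plus (M t))) = ennreal (\<kappa> / max 1 (log_plus (M t)))" for t
  proof -
    have "0 \<le> log_plus (M t)" by (simp add: log_plus_def)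
    then consider "log_plus (M t) = 0" | "0 < log_plus (M t)" by linarith
    then have "min 1 (1 / ennreal (log_plus (M t))) = ennreal (1 / max 1 (log_plus (M t)))"
    proof cases
      case 2
      then have "1 / ennreal (log_plus (M t)) = ennreal (1 / log_plus (M t))"
        using divide_ennreal[of 1 "log_plus (M t)"] by simp
      moreover have "min 1 (1 / log_plus (M t)) = 1 / max 1 (log_plus (M t))"
        using 2 by (auto simp: min_def max_def divide_simps)
      moreover have "min 1 (ennreal r) = ennreal (min 1 r)" for r :: real
        by (auto simp: min_def)
      ultimately show ?thesis by simp
    qed simp
    then show ?thesis
      using assms by (simp flip: ennreal_mult)
  qed
  then show ?thesis unfolding loglog_measure_def by simp
qed

text \<open>The class \<open>class_Lpp a b\<close> is tailored to this: \<open>-log\<close> of the density is \<open>log\<^sup>+ log\<^sup>+ M - log \<kappa>\<close>.\<close>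

lemma loglog_density_in_Lminus:
  assumes M: "M \<in> class_Lpp a b" and "0 < \<kappa>"
  shows "(\<lambda>t. \<kappa> / max 1 (log_plus (M t))) \<in> class_Lminus a b"
proof -
  define L where "L = lebesgue_on {a..b}"
  have [measurable]: "M \<in> borel_measurable L"
    and fin: "(\<integral>\<^sup>+t. ennreal (log_plus (log_plus (M t))) \<partial>L) < \<infinity>"
    using M by (auto simp: class_Lpp_def L_def)
  interpret L: finite_measure L
    unfolding L_def by (metis cbox_interval finite_measure_lebesgue_on lmeasurable_cbox)
  have [measurable]: "(\<lambda>t. log_plus (M t)) \<in> borel_measurable L"
    unfolding log_plus_def by measurable
  have "integrable L (\<lambda>t. \<kappa> / max 1 (log_plus (M t)))"
    using \<open>0 < \<kappa>\<close> by (intro L.integrable_const_bound[where B=\<kappa>]) (auto simp: divide_simps)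
  moreover have "(\<integral>\<^sup>+t. log_minus (\<kappa> / max 1 (log_plus (M t))) \<partial>L) < \<infinity>"
  proof (rule order_le_less_trans)
    show "(\<integral>\<^sup>+t. log_minus (\<kappa> / max 1 (log_plus (M t))) \<partial>L)
        \<le> (\<integral>\<^sup>+t. ennreal \<bar>ln \<kappa>\<bar> + ennreal (log_plus (log_plus (M t))) \<partial>L)"
    proof (rule nn_integral_mono)
      fix t
      have "ln (max 1 (log_plus (M t))) = log_plus (log_plus (M t))"
        by (auto simp: log_plus_def max_def)
      then have "- ln (\<kappa> / max 1 (log_plus (M t))) \<le> \<bar>ln \<kappa>\<bar> + log_plus (log_plus (M t))"
        using \<open>0 < \<kappa>\<close> by (subst ln_div) auto
      moreover have "0 \<le> log_plus (log_plus (M t))" by (simp add: log_plus_def)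
      ultimately show "log_minus (\<kappa> / max 1 (log_plus (M t)))
          \<le> ennreal \<bar>ln \<kappa>\<bar> + ennreal (log_plus (log_plus (M t)))"
        using \<open>0 < \<kappa>\<close> by (auto simp: log_minus_def simp flip: ennreal_plus intro!: ennreal_leI)
    qed
    have "(\<integral>\<^sup>+t. ennreal \<bar>ln \<kappa>\<bar> + ennreal (log_plus (log_plus (M t))) \<partial>L)
        = ennreal \<bar>ln \<kappa>\<bar> * emeasure L (space L) + (\<integral>\<^sup>+t. ennreal (log_plus (log_plus (M t))) \<partial>L)"
      by (subst nn_integral_add) (auto simp: log_plus_def)
    also have "\<dots> < \<infinity>"
      using fin L.emeasure_finite[of "space L"]
      by (auto simp: ennreal_mult_eq_top_iff less_top[symmetric])
    finally show "(\<integral>\<^sup>+t. ennreal \<bar>ln \<kappa>\<bar> + ennreal (log_plus (log_plus (M t))) \<partial>L) < \<infinity>" .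
  qed
  ultimately show ?thesis using \<open>0 < \<kappa>\<close> by (auto simp: class_Lminus_def L_def)
qed

text \<open>The total mass is \<open>\<kappa> I\<close>, where \<open>I\<close> is the mass for \<open>\<kappa> = 1\<close>. It is finite because that density is at
  most \<open>1\<close>, and positive because \<open>log\<^sup>+ M\<close> is finite everywhere.\<close>

lemma ex1_loglog_normalizing_constant:
  assumes "a < b" and M: "M \<in> class_Lpp a b"
  shows "\<exists>!\<kappa>. 0 < \<kappa> \<and> prob_space (loglog_measure a b M \<kappa>)"
proof -
  define L where "L = lebesgue_on {a..b}"
  define w where "w t = 1 / max 1 (log_plus (M t))" for t
  have w: "integrable L w" and w0: "0 < w t" for t
    using loglog_density_in_Lminus[OF M, of 1] by (auto simp: class_Lminus_def L_def w_def[abs_def])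
  have [measurable]: "w \<in> borel_measurable L" using w by auto
  define I where "I = integral\<^sup>L L w"
  have nn: "(\<integral>\<^sup>+t. ennreal (w t) \<partial>L) = ennreal I"
    unfolding I_def using w w0 by (intro nn_integral_eq_integral) (auto intro: less_imp_le)
  have "I \<noteq> 0"
  proof
    assume "I = 0"
    then have "AE t in L. ennreal (w t) = 0" using nn by (simp add: nn_integral_0_iff_AE)
    then have "AE t in L. False"
    proof eventually_elim
      case (elim t)
      then show ?case using w0[of t] by (simp add: ennreal_eq_0_iff)
    qed
    then have "emeasure L (space L) = 0" by (subst (asm) AE_iff_measurable[where N="space L"]) auto
    then show False using \<open>a < b\<close> by (simp add: L_def emeasure_restrict_space)
  qed
  moreover have "0 \<le> I" unfolding I_def using w0 by (intro Bochner_Integration.integral_nonneg) (auto intro: less_imp_le)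
  ultimately have "0 < I" by simp
  have prob: "prob_space (loglog_measure a b M \<kappa>) \<longleftrightarrow> \<kappa> * I = 1" if "0 < \<kappa>" for \<kappa>
  proof -
    have "emeasure (loglog_measure a b M \<kappa>) (space (loglog_measure a b M \<kappa>))
        = (\<integral>\<^sup>+t. ennreal (\<kappa> / max 1 (log_plus (M t))) * indicator (space L) t \<partial>L)"
      unfolding loglog_measure_eq_density[OF that] L_def[symmetric] space_density
      using loglog_density_in_Lminus[OF M that]
      by (intro emeasure_density) (auto simp: class_Lminus_def L_def)
    also have "\<dots> = (\<integral>\<^sup>+t. ennreal \<kappa> * ennreal (w t) \<partial>L)"
      using that w0 by (intro nn_integral_cong) (simp add: w_def flip: ennreal_mult)
    also have "\<dots> = ennreal (\<kappa> * I)"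
      using that \<open>0 < I\<close> by (simp add: nn_integral_cmult nn ennreal_mult)
    finally show ?thesis
      using that \<open>0 < I\<close> by (auto intro!: prob_spaceI dest: prob_space.emeasure_space_1)
  qed
  show ?thesis
    using \<open>0 < I\<close> by (intro ex1I[of _ "1 / I"]) (auto simp: prob field_simps)
qed

text \<open>The density is at most \<open>\<kappa>\<close>, so the distribution function is Lipschitz and has no atoms; its
  increments are then exactly the integrals of the density.\<close>

lemma loglog_distribution_in_class_A:
  assumes "a < b" and M: "M \<in> class_Lpp a b" and "0 < \<kappa>"
    and prob: "prob_space (loglog_measure a b M \<kappa>)"
  shows "distribution_function a (loglog_measure a b M \<kappa>) \<in> class_A a b"
proof -
  define L where "L = lebesgue_on {a..b}"
  define g where "g t = \<kappa> / max 1 (log_plus (M t))" for t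
  define N where "N = loglog_measure a b M \<kappa>"
  define F where "F = distribution_function a N"
  have g: "g \<in> class_Lminus a b" using loglog_density_in_Lminus[OF M \<open>0 < \<kappa>\<close>] by (simp add: g_def[abs_def])
  then have [measurable]: "g \<in> borel_measurable L" by (auto simp: class_Lminus_def L_def)
  have N_eq: "N = density L (\<lambda>t. ennreal (g t))"
    using \<open>0 < \<kappa>\<close> by (simp add: N_def L_def g_def loglog_measure_eq_density)
  interpret N: prob_space N using prob by (simp add: N_def)
  have Icc[measurable]: "{s..t} \<in> sets L" if "a \<le> s" "t \<le> b" for s t
    using that by (auto simp: L_def sets_restrict_space_iff)
  have emN: "emeasure N {s..t} = (\<integral>\<^sup>+x\<in>{s..t}. ennreal (g x) \<partial>L)" if "a \<le> s" "t \<le> b" for s t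
    unfolding N_eq using Icc[OF that] by (intro emeasure_density) auto
  have N_le: "measure N {s..t} \<le> \<kappa> * (t - s)" if "a \<le> s" "s \<le> t" "t \<le> b" for s t
  proof -
    have "emeasure N {s..t} \<le> (\<integral>\<^sup>+x. ennreal \<kappa> * indicator {s..t} x \<partial>L)"
      unfolding emN[OF that(1,3)] g_def using \<open>0 < \<kappa>\<close>
      by (intro nn_integral_mono) (auto intro!: ennreal_leI simp: divide_simps split: split_indicator)
    also have "\<dots> = ennreal \<kappa> * emeasure L {s..t}"
      using that by (intro nn_integral_cmult_indicator Icc) auto
    also have "\<dots> = ennreal (\<kappa> * (t - s))"
      using that \<open>0 < \<kappa>\<close> by (simp add: L_def emeasure_restrict_space ennreal_mult)
    finally show ?thesis
      using that \<open>0 < \<kappa>\<close> by (simp add: N.emeasure_eq_measure)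
  qed
  have split: "F t - F s = measure N {s..t}" if "a \<le> s" "s \<le> t" "t \<le> b" for s t
  proof -
    have sets: "{a..s} \<in> sets N" "{s..t} \<in> sets N" "{s} \<in> sets N"
      using that Icc[of s s] by (auto simp: N_eq intro!: Icc)
    have "measure N {s} = 0" using N_le[of s s] that by (simp add: measure_le_0_iff)
    have "{a..t} = {a..s} \<union> ({s..t} - {s})" using that by auto
    then have "measure N {a..t} = measure N ({a..s} \<union> ({s..t} - {s}))" by simp
    also have "\<dots> = measure N {a..s} + measure N ({s..t} - {s})"
      using sets by (intro N.finite_measure_Union) auto
    also have "measure N ({s..t} - {s}) = measure N {s..t}"
      using sets \<open>measure N {s} = 0\<close> that by (subst N.finite_measure_Diff) auto
    finally show ?thesis by (simp add: F_def distribution_function_def)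
  qed
  have F_mono: "F s \<le> F t" if "a \<le> s" "s \<le> t" "t \<le> b" for s t
    using split[OF that] measure_nonneg[of N "{s..t}"] by linarith
  have "\<kappa>-lipschitz_on {a..b} F"
  proof (rule lipschitz_on_leI)
    fix s t assume "s \<in> {a..b}" "t \<in> {a..b}" "s \<le> t"
    then show "dist (F s) (F t) \<le> \<kappa> * dist s t"
      using split[of s t] N_le[of s t] F_mono[of s t]
      by (simp add: dist_real_def)
  qed (use \<open>0 < \<kappa>\<close> in simp)
  then have "continuous_on {a..b} F" by (rule lipschitz_on_continuous_on)
  moreover have "mono_on {a..b} F"
    using F_mono by (intro mono_onI) auto
  moreover have "F a = 0"
    using N_le[of a a] \<open>a < b\<close> by (simp add: F_def distribution_function_def measure_le_0_iff)
  moreover have "F b = 1"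
    using N.prob_space by (simp add: F_def distribution_function_def N_eq L_def)
  moreover have "(\<integral>\<^sup>+x\<in>{s..t}. ennreal (g x) \<partial>lebesgue_on {a..b}) \<le> ennreal (F t - F s)"
    if "a \<le> s" "s \<le> t" "t \<le> b" for s t
    using emN[of s t] that by (simp add: split N.emeasure_eq_measure flip: L_def)
  ultimately have "F \<in> class_A a b"
    using \<open>a < b\<close> g by (intro class_A_if_density_le_increment[where g=g]) auto
  then show ?thesis by (simp add: F_def N_def)
qed

text \<open>Monotonicity of the nonnegative integral replaces \<open>u\<close> by
  \<open>M\<close>, and the density was chosen so that its product with \<open>log\<^sup>+ M\<close> is bounded by \<open>\<kappa>\<close>.\<close>

lemma nn_integral_log_plus_loglog_le:
  assumes M: "M \<in> class_Lpp a b" and "a \<le> b" and "0 < \<kappa>"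
    and u: "\<And>t. t \<in> {a..b} \<Longrightarrow> 0 \<le> u t \<and> u t \<le> M t"
  shows "(\<integral>\<^sup>+t. ennreal (log_plus (u t)) \<partial>loglog_measure a b M \<kappa>) \<le> ennreal (\<kappa> * (b - a))"
proof -
  define L where "L = lebesgue_on {a..b}"
  have [simp]: "space L = {a..b}" by (simp add: L_def)
  have [measurable]: "M \<in> borel_measurable L" using M by (auto simp: class_Lpp_def L_def)
  have N: "loglog_measure a b M \<kappa> = density L (\<lambda>t. ennreal (\<kappa> / max 1 (log_plus (M t))))"
    using \<open>0 < \<kappa>\<close> by (simp add: L_def loglog_measure_eq_density)
  have "(\<integral>\<^sup>+t. ennreal (log_plus (u t)) \<partial>loglog_measure a b M \<kappa>)
      \<le> (\<integral>\<^sup>+t. ennreal (log_plus (M t)) \<partial>loglog_measure a b M \<kappa>)"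
  proof (rule nn_integral_mono)
    fix t assume "t \<in> space (loglog_measure a b M \<kappa>)"
    then have "0 \<le> u t" "u t \<le> M t" using u by (auto simp: N)
    then have "log_plus (u t) \<le> log_plus (M t)"
      by (cases "u t = 0") (auto simp: log_plus_def max_def)
    then show "ennreal (log_plus (u t)) \<le> ennreal (log_plus (M t))" by (rule ennreal_leI)
  qed
  also have "\<dots> = (\<integral>\<^sup>+t. ennreal (\<kappa> / max 1 (log_plus (M t))) * ennreal (log_plus (M t)) \<partial>L)"
    unfolding N by (rule nn_integral_density) (auto simp: log_plus_def)
  also have "\<dots> \<le> (\<integral>\<^sup>+t. ennreal \<kappa> \<partial>L)"
  proof (rule nn_integral_mono)
    fix t
    have "\<kappa> / max 1 (log_plus (M t)) * log_plus (M t) \<le> \<kappa>"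
      using \<open>0 < \<kappa>\<close> by (auto simp: log_plus_def divide_simps)
    moreover have "0 \<le> log_plus (M t)" by (simp add: log_plus_def)
    ultimately show "ennreal (\<kappa> / max 1 (log_plus (M t))) * ennreal (log_plus (M t)) \<le> ennreal \<kappa>"
      using \<open>0 < \<kappa>\<close> by (simp add: ennreal_leI flip: ennreal_mult)
  qed
  also have "\<dots> = ennreal (\<kappa> * (b - a))"
    using \<open>a \<le> b\<close> \<open>0 < \<kappa>\<close> by (simp add: L_def emeasure_restrict_space ennreal_mult)
  finally show ?thesis .
qed

theorem proposition1:
  fixes a b :: real
  assumes "a < b"
  shows
    "(\<forall>\<nu> g :: real \<Rightarrow> real.
        abs_continuous_on a b \<nu> \<and> mono_on {a..b} \<nu> \<and> \<nu> a = 0 \<and> \<nu> b = 1 \<and>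
        ae_derivative_on a b \<nu> g \<and> g \<in> class_Lminus a b \<longrightarrow> \<nu> \<in> class_A a b)
     \<and>
     (\<forall>M \<in> class_Lpp a b.
        (\<exists>!\<kappa>. 0 < \<kappa> \<and> prob_space (loglog_measure a b M \<kappa>)) \<and>
        (\<forall>\<kappa>>0. prob_space (loglog_measure a b M \<kappa>) \<longrightarrow>
           distribution_function a (loglog_measure a b M \<kappa>) \<in> class_A a b \<and>
           (\<exists>C::real. \<forall>(f :: complex \<Rightarrow> complex) D \<gamma>.
              open D \<and> f holomorphic_on D \<and> continuous_on {a..b} \<gamma> \<and> \<gamma> ` {a..b} \<subseteq> D \<and>
              (\<forall>t\<in>{a..b}. cmod (f (\<gamma> t)) \<le> M t) \<longrightarrow>
              (\<integral>\<^sup>+t. ennreal (log_plus (cmod (f (\<gamma> t)))) \<partial>loglog_measure a b M \<kappa>) \<le> ennreal C)))"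
proof (intro conjI allI ballI impI)
  fix \<nu> g :: "real \<Rightarrow> real"
  assume "abs_continuous_on a b \<nu> \<and> mono_on {a..b} \<nu> \<and> \<nu> a = 0 \<and> \<nu> b = 1 \<and>
    ae_derivative_on a b \<nu> g \<and> g \<in> class_Lminus a b"
  with \<open>a < b\<close> show "\<nu> \<in> class_A a b"
    by (intro class_A_if_density_le_increment[where g=g] nn_integral_derivative_le_increment
        abs_continuous_on_imp_continuous_on) auto
next
  fix M assume M: "M \<in> class_Lpp a b"
  show "\<exists>!\<kappa>. 0 < \<kappa> \<and> prob_space (loglog_measure a b M \<kappa>)"
    using \<open>a < b\<close> M by (rule ex1_loglog_normalizing_constant)
  fix \<kappa> :: real assume \<kappa>: "0 < \<kappa>" "prob_space (loglog_measure a b M \<kappa>)"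
  show "distribution_function a (loglog_measure a b M \<kappa>) \<in> class_A a b"
    using \<open>a < b\<close> M \<kappa> by (rule loglog_distribution_in_class_A)
  show "\<exists>C::real. \<forall>(f :: complex \<Rightarrow> complex) D \<gamma>.
      open D \<and> f holomorphic_on D \<and> continuous_on {a..b} \<gamma> \<and> \<gamma> ` {a..b} \<subseteq> D \<and>
      (\<forall>t\<in>{a..b}. cmod (f (\<gamma> t)) \<le> M t) \<longrightarrow>
      (\<integral>\<^sup>+t. ennreal (log_plus (cmod (f (\<gamma> t)))) \<partial>loglog_measure a b M \<kappa>) \<le> ennreal C"
    using \<open>a < b\<close> M \<kappa>(1)
    by (intro exI[of _ "\<kappa> * (b - a)"] allI impI nn_integral_log_plus_loglog_le) auto
qed

end
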